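(* The automorphisms $\mathbf a,\mathbf s:\mathcal A\to\mathcal A$ of the algebra $\mathcal A$ (all defined in the context) satisfy the defining relations of $PSL(2,\mathbb Z)$: $$(\mathbf a\mathbf s)^3=\mathrm{Id}=\mathbf s^2 .$$
   Context: **Algebra $\mathcal A$.** Let $Free_2=\langle a,b\rangle$ be the free group on two generators and $\sigma$ its automorphism exchanging $a$ and $b$. Let $\mathbf k=\mathbb C(Q)$ and let $\mathcal F=\mathbf k\langle \mathcal O_A^{(g)},\mathcal O_B^{(g)}\mid g\in Free_2\rangle$ be the free associative $\mathbf k$-algebra. Let $\mathcal I\subset\mathcal F$ be the two-sided ideal generated by the following elements, for all $g,g_1,g_2,g_3\in Free_2$ and $X\in\{A,B\}$: - $\mathcal R_{0,A}^{(g)}=\mathcal O_A^{(ag)}-\mathcal O_A^{(g)}$, $\ \mathcal R_{0,B}^{(g)}=\mathcal O_B^{(bg)}-\mathcal O_B^{(g)}$; - $\mathcal R_{1,X}^{(g)}=\mathcal O_X^{(g)}\mathcal O_X^{(g)}-\mathcal O_X^{(1)}\mathcal O_X^{(1)}$; - $\mathcal R_2^{(g_1,g_2,g_3)}=\mathcal O_B^{(g_1)}\mathcal O_A^{(g_2)}\mathcal O_B^{(g_3)}$, $\ \mathcal R_3^{(g_1,g_2,g_3)}=\mathcal O_A^{(g_1)}\mathcal O_B^{(g_2)}\mathcal O_A^{(g_3)}$; - $\mathcal R_{4,X}^{(g)}=\mathcal O_X^{(1)}\mathcal O_X^{(1)}\mathcal O_X^{(g)}+(Q^2-Q^{-2})^2\mathcal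 O_X^{(g)}$, $\ \mathcal R_{5,X}^{(g)}=\mathcal O_X^{(g)}\mathcal O_X^{(1)}\mathcal O_X^{(1)}+(Q^2-Q^{-2})^2\mathcal O_X^{(g)}$; - $\mathcal R_6^{(g)}=\mathcal O_A^{(1)}\mathcal O_A^{(1)}\mathcal O_B^{(g)}+(Q^2-Q^{-2})^2\mathcal O_B^{(g)}+\mathcal O_B^{(g)}\mathcal O_A^{(1)}\mathcal O_A^{(1)}$; - $\mathcal R_7^{(g)}=\mathcal O_B^{(1)}\mathcal O_B^{(1)}\mathcal O_A^{(g)}+(Q^2-Q^{-2})^2\mathcal O_A^{(g)}+\mathcal O_A^{(g)}\mathcal O_B^{(1)}\mathcal O_B^{(1)}$; - $\mathcal R_8^{(g_1,g_2)}=\mathcal O_A^{(g_2)}\mathcal O_A^{(g_1abag_2)}\mathcal O_B^{(ag_2)}+\mathcal O_B^{(ag_2)}\mathcal O_A^{(g_1abag_2)}\mathcal O_A^{(g_2)}-\mathcal O_B^{(g_2)}\mathcal O_B^{(\sigma(g_1)g_2)}\mathcal O_B^{(g_2)}$; - $\mathcal R_9^{(g_1,g_2)}=\mathcal O_B^{(g_2)}\mathcal O_B^{(g_1babg_2)}\mathcal O_A^{(bg_2)}+\mathcal O_A^{(bg_2)}\mathcal O_B^{(g_1babg_2)}\mathcal O_B^{(g_2)}-\mathcal O_A^{(g_2)}\mathcal O_A^{(\sigma(g_1)g_2)}\mathcal O_A^{(g_2)}$; - $\mathcal R_{10}^{(g_1,g_2)}=\mathcal O_A^{(g_2)}\mathcal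 O_A^{(g_1a^{-1}b^{-1}a^{-1}g_2)}\mathcal O_B^{(a^{-1}g_2)}+\mathcal O_B^{(a^{-1}g_2)}\mathcal O_A^{(g_1a^{-1}b^{-1}a^{-1}g_2)}\mathcal O_A^{(g_2)}-\mathcal O_B^{(g_2)}\mathcal O_B^{(\sigma(g_1)g_2)}\mathcal O_B^{(g_2)}$; - $\mathcal R_{11}^{(g_1,g_2)}=\mathcal O_B^{(g_2)}\mathcal O_B^{(g_1b^{-1}a^{-1}b^{-1}g_2)}\mathcal O_A^{(b^{-1}g_2)}+\mathcal O_A^{(b^{-1}g_2)}\mathcal O_B^{(g_1b^{-1}a^{-1}b^{-1}g_2)}\mathcal O_B^{(g_2)}-\mathcal O_A^{(g_2)}\mathcal O_A^{(\sigma(g_1)g_2)}\mathcal O_A^{(g_2)}$. Then $\mathcal A=\mathcal F/\mathcal I$. **Automorphisms.** $\mathbf s,\mathbf a$ are the $\mathbf k$-algebra automorphisms of $\mathcal A$ given on generators by $\mathbf s(\mathcal O_A^{(g)})=\mathcal O_B^{(\sigma(g))}$, $\mathbf s(\mathcal O_B^{(g)})=\mathcal O_A^{(\sigma(g))}$ and $$\mathbf a(\mathcal O_A^{(g)})=-\frac{\mathcal O_A^{(1)}\mathcal O_A^{(ga^{-1})}\mathcal O_A^{(1)}}{(Q^2-Q^{-2})^2},\qquad \mathbf a(\mathcal O_B^{(g)})=\frac{Q\,\mathcal O_A^{(1)}\mathcal O_B^{(ga^{-1})}-Q^{-1}\mathcal O_B^{(ga^{-1})}\mathcal O_A^{(1)}}{Q^2-Q^{-2}}.$$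 *)

theory Defs
  imports
    "HOL-Library.Poly_Mapping"
    "HOL-Computational_Algebra.Fraction_Field"
    "HOL-Computational_Algebra.Polynomial"
begin

datatype gen2 = Gen_a | Gen_b

text \<open>A letter \<open>(x, True)\<close> stands for the generator \<open>x\<close>, and \<open>(x, False)\<close> for its inverse.\<close>

inductive cancels_to :: "(gen2 \<times> bool) list \<Rightarrow> (gen2 \<times> bool) list \<Rightarrow> bool" where
  "cancels_to (u @ [(x, e), (x, \<not> e)] @ v) (u @ v)"

quotient_type free2 = "(gen2 \<times> bool) list" / "equivclp cancels_to"
  by (rule equivp_evquivclp)

lemma equivclp_lift:
  assumes "equivclp r x y" and "\<And>x y. r x y \<Longrightarrow> equivclp s (f x) (f y)"
  shows "equivclp s (f x) (f y)"
  using assms(1)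
proof (induction rule: equivclp_induct)
  case base
  show ?case by simp
next
  case (step y z)
  then have "equivclp s (f y) (f z)"
    using assms(2) equivclp_sym by metis
  then show ?case using step.IH equivclp_trans by metis
qed

lemma equivclp_cancels_to_append:
  assumes "equivclp cancels_to u u'" and "equivclp cancels_to v v'"
  shows "equivclp cancels_to (u @ v) (u' @ v')"
proof -
  have "equivclp cancels_to (u @ v) (u' @ v)"
  proof (rule equivclp_lift[OF assms(1)])
    fix x y assume "cancels_to x y"
    then obtain p q z e where "x = p @ [(z, e), (z, \<not> e)] @ q" "y = p @ q"
      by (cases rule: cancels_to.cases) blast
    then have "cancels_to (x @ v) (y @ v)"
      using cancels_to.intros[of p z e "q @ v"] by simp
    then show "equivclp cancels_to (x @ v) (y @ v)" by blast
  qed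
  moreover have "equivclp cancels_to (u' @ v) (u' @ v')"
  proof (rule equivclp_lift[OF assms(2)])
    fix x y assume "cancels_to x y"
    then obtain p q z e where "x = p @ [(z, e), (z, \<not> e)] @ q" "y = p @ q"
      by (cases rule: cancels_to.cases) blast
    then have "cancels_to (u' @ x) (u' @ y)"
      using cancels_to.intros[of "u' @ p" z e q] by simp
    then show "equivclp cancels_to (u' @ x) (u' @ y)" by blast
  qed
  ultimately show ?thesis by (rule equivclp_trans)
qed

definition invert_word :: "('x \<times> bool) list \<Rightarrow> ('x \<times> bool) list" where
  "invert_word w = rev (map (apsnd Not) w)"

lemma equivclp_cancels_to_invert_word:
  assumes "equivclp cancels_to u v"
  shows "equivclp cancels_to (invert_word u) (invert_word v)"
proof (rule equivclp_lift[OF assms])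
  fix x y assume "cancels_to x y"
  then obtain u v z e where "x = u @ [(z, e), (z, \<not> e)] @ v" "y = u @ v"
    by (cases rule: cancels_to.cases) blast
  then have "cancels_to (invert_word x) (invert_word y)"
    using cancels_to.intros[of "invert_word v" z e "invert_word u"]
    by (simp add: invert_word_def)
  then show "equivclp cancels_to (invert_word x) (invert_word y)" by blast
qed

lemma cancels_to_invert_word_left: "equivclp cancels_to (invert_word w @ w) []"
proof (induction w)
  case Nil
  show ?case by (simp add: invert_word_def)
next
  case (Cons l w)
  obtain x e where l: "l = (x, e)" by (cases l)
  have "cancels_to (invert_word (l # w) @ l # w) (invert_word w @ w)"
    using cancels_to.intros[of "invert_word w" x "\<not> e" w] by (simp add: invert_word_def l)
  then show ?case using Cons.IH by (meson equivclp_trans r_into_equivclp)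
qed

instantiation free2 :: "{monoid_mult, inverse}"
begin

lift_definition one_free2 :: free2 is "[]" .

lift_definition times_free2 :: "free2 \<Rightarrow> free2 \<Rightarrow> free2" is "(@)"
  by (rule equivclp_cancels_to_append)

lift_definition inverse_free2 :: "free2 \<Rightarrow> free2" is invert_word
  by (rule equivclp_cancels_to_invert_word)

definition divide_free2 :: "free2 \<Rightarrow> free2 \<Rightarrow> free2" where
  "divide_free2 g h = g * inverse h"

instance
  by standard (transfer; simp)+

end

lemma free2_left_inverse: "inverse g * g = (1 :: free2)"
  by transfer (rule cancels_to_invert_word_left)

lift_definition gen_a :: free2 is "[(Gen_a, True)]" .
lift_definition gen_b :: free2 is "[(Gen_b, True)]" .

fun swap_gen :: "gen2 \<Rightarrow> gen2" where
  "swap_gen Gen_a = Gen_b"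
| "swap_gen Gen_b = Gen_a"

lift_definition \<sigma> :: "free2 \<Rightarrow> free2" is "map (apfst swap_gen)"
proof (erule equivclp_lift)
  fix x y assume "cancels_to x y"
  then obtain u v z e where "x = u @ [(z, e), (z, \<not> e)] @ v" "y = u @ v"
    by (cases rule: cancels_to.cases) blast
  then have "cancels_to (map (apfst swap_gen) x) (map (apfst swap_gen) y)"
    using cancels_to.intros[of "map (apfst swap_gen) u" "swap_gen z" e "map (apfst swap_gen) v"]
    by simp
  then show "equivclp cancels_to (map (apfst swap_gen) x) (map (apfst swap_gen) y)" by blast
qed

lemma \<sigma>_simps:
  "\<sigma> gen_a = gen_b" "\<sigma> gen_b = gen_a" "\<sigma> 1 = 1" "\<sigma> (g * h) = \<sigma> g * \<sigma> h" "\<sigma> (\<sigma> g) = g"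
proof -
  have [simp]: "swap_gen (swap_gen x) = x" for x by (cases x) auto
  have [simp]: "apfst swap_gen \<circ> apfst swap_gen = (id :: gen2 \<times> bool \<Rightarrow> _)"
    by (auto simp: fun_eq_iff)
  show "\<sigma> gen_a = gen_b" "\<sigma> gen_b = gen_a" "\<sigma> 1 = 1" "\<sigma> (g * h) = \<sigma> g * \<sigma> h" "\<sigma> (\<sigma> g) = g"
    by (transfer; simp)+
qed

type_synonym k = "complex poly fract"

definition Q :: k where "Q = Fraction_Field.Fract [:0, 1:] 1"

text \<open>
  Words over an alphabet, written additively: with this \<open>monoid_add\<close> structure on the keys,
  the ring structure of \<open>Poly_Mapping\<close> on finitely supported functions from words to scalars
  is the convolution product, i.e. that of the free associative algebra.
\<close>

datatype 'x word = Word (letters: "'x list")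

instantiation word :: (type) monoid_add
begin

definition zero_word :: "'a word" where "0 = Word []"

definition plus_word :: "'a word \<Rightarrow> 'a word \<Rightarrow> 'a word" where
  "u + v = Word (letters u @ letters v)"

instance
  by standard (simp_all add: zero_word_def plus_word_def)

end

datatype label = Lab_A | Lab_B

type_synonym free_alg = "(label \<times> free2) word \<Rightarrow>\<^sub>0 k"

definition free_gen :: "label \<Rightarrow> free2 \<Rightarrow> free_alg" where
  "free_gen X g = Poly_Mapping.single (Word [(X, g)]) 1"

abbreviation fA :: "free2 \<Rightarrow> free_alg" where "fA \<equiv> free_gen Lab_A"
abbreviation fB :: "free2 \<Rightarrow> free_alg" where "fB \<equiv> free_gen Lab_B"

definition free_scale :: "k \<Rightarrow> free_alg \<Rightarrow> free_alg" (infixr "*\<^sub>F" 75) where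
  "c *\<^sub>F x = Poly_Mapping.single 0 c * x"

definition kap :: k where "kap = Q ^ 2 - inverse Q ^ 2"

inductive_set relators :: "free_alg set" where
  R0A: "fA (gen_a * g) - fA g \<in> relators"
| R0B: "fB (gen_b * g) - fB g \<in> relators"
| R1: "free_gen X g * free_gen X g - free_gen X 1 * free_gen X 1 \<in> relators"
| R2: "fB g1 * fA g2 * fB g3 \<in> relators"
| R3: "fA g1 * fB g2 * fA g3 \<in> relators"
| R4: "free_gen X 1 * free_gen X 1 * free_gen X g + kap ^ 2 *\<^sub>F free_gen X g \<in> relators"
| R5: "free_gen X g * free_gen X 1 * free_gen X 1 + kap ^ 2 *\<^sub>F free_gen X g \<in> relators"
| R6: "fA 1 * fA 1 * fB g + kap ^ 2 *\<^sub>F fB g + fB g * fA 1 * fA 1 \<in> relators"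
| R7: "fB 1 * fB 1 * fA g + kap ^ 2 *\<^sub>F fA g + fA g * fB 1 * fB 1 \<in> relators"
| R8: "fA g2 * fA (g1 * gen_a * gen_b * gen_a * g2) * fB (gen_a * g2)
       + fB (gen_a * g2) * fA (g1 * gen_a * gen_b * gen_a * g2) * fA g2
       - fB g2 * fB (\<sigma> g1 * g2) * fB g2 \<in> relators"
| R9: "fB g2 * fB (g1 * gen_b * gen_a * gen_b * g2) * fA (gen_b * g2)
       + fA (gen_b * g2) * fB (g1 * gen_b * gen_a * gen_b * g2) * fB g2
       - fA g2 * fA (\<sigma> g1 * g2) * fA g2 \<in> relators"
| R10: "fA g2 * fA (g1 * inverse gen_a * inverse gen_b * inverse gen_a * g2) * fB (inverse gen_a * g2)
       + fB (inverse gen_a * g2) * fA (g1 * inverse gen_a * inverse gen_b * inverse gen_a * g2) * fA g2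
       - fB g2 * fB (\<sigma> g1 * g2) * fB g2 \<in> relators"
| R11: "fB g2 * fB (g1 * inverse gen_b * inverse gen_a * inverse gen_b * g2) * fA (inverse gen_b * g2)
       + fA (inverse gen_b * g2) * fB (g1 * inverse gen_b * inverse gen_a * inverse gen_b * g2) * fB g2
       - fA g2 * fA (\<sigma> g1 * g2) * fA g2 \<in> relators"

definition two_sided_ideal :: "'r::ring_1 set \<Rightarrow> bool" where
  "two_sided_ideal I \<longleftrightarrow>
     0 \<in> I \<and> (\<forall>x\<in>I. \<forall>y\<in>I. x + y \<in> I) \<and> (\<forall>r. \<forall>x\<in>I. r * x \<in> I \<and> x * r \<in> I)"

definition ideal_A :: "free_alg set" where
  "ideal_A = two_sided_ideal hull relators"

lemma two_sided_ideal_ideal_A: "two_sided_ideal ideal_A"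
  unfolding ideal_A_def by (rule hull_in) (auto simp: two_sided_ideal_def)

lemma ideal_A_closed:
  "0 \<in> ideal_A"
  "x \<in> ideal_A \<Longrightarrow> y \<in> ideal_A \<Longrightarrow> x + y \<in> ideal_A"
  "x \<in> ideal_A \<Longrightarrow> r * x \<in> ideal_A"
  "x \<in> ideal_A \<Longrightarrow> x * r \<in> ideal_A"
  "x \<in> ideal_A \<Longrightarrow> - x \<in> ideal_A"
  "x \<in> ideal_A \<Longrightarrow> y \<in> ideal_A \<Longrightarrow> x - y \<in> ideal_A"
proof -
  show *: "0 \<in> ideal_A" "x \<in> ideal_A \<Longrightarrow> y \<in> ideal_A \<Longrightarrow> x + y \<in> ideal_A"
    "x \<in> ideal_A \<Longrightarrow> r * x \<in> ideal_A" "x \<in> ideal_A \<Longrightarrow> x * r \<in> ideal_A" for x y r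
    using two_sided_ideal_ideal_A unfolding two_sided_ideal_def by blast+
  show m: "x \<in> ideal_A \<Longrightarrow> - x \<in> ideal_A" for x
    using *(3)[of x "- 1"] by simp
  show "x \<in> ideal_A \<Longrightarrow> y \<in> ideal_A \<Longrightarrow> x - y \<in> ideal_A"
    using *(2)[of x "- y"] m by simp
qed

text \<open>
  Properness of the ideal, needed only because \<open>ring_1\<close> includes \<open>0 \<noteq> 1\<close>: every relator has
  zero constant term.
\<close>

lemma word_plus_eq_0_iff: "u + v = (0 :: 'x word) \<longleftrightarrow> u = 0 \<and> v = 0"
  by (cases u; cases v) (simp add: zero_word_def plus_word_def)

lemma constant_term_mult:
  fixes x y :: "'x word \<Rightarrow>\<^sub>0 'r::semiring_1"
  shows "Poly_Mapping.lookup (x * y) 0 = Poly_Mapping.lookup x 0 * Poly_Mapping.lookup y 0"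
proof -
  have eq: "Sum_any (\<lambda>q. Poly_Mapping.lookup y q when 0 = l + q)
      = (Poly_Mapping.lookup y 0 when l = 0)" for l :: "'x word"
  proof -
    have "(Poly_Mapping.lookup y q when 0 = l + q)
        = ((Poly_Mapping.lookup y 0 when l = 0) when q = 0)" for q
      using word_plus_eq_0_iff[of l q] by (auto simp: when_def)
    then show ?thesis by simp
  qed
  show ?thesis
    unfolding lookup_mult eq by (simp add: mult_when)
qed

lemma constant_term_free_gen [simp]: "Poly_Mapping.lookup (free_gen X g) 0 = 0"
  by (simp add: free_gen_def zero_word_def lookup_single when_def)

lemma one_notin_ideal_A: "1 \<notin> ideal_A"
proof -
  have "ideal_A \<subseteq> {x. Poly_Mapping.lookup x 0 = 0}"
    unfolding ideal_A_def
  proof (rule hull_minimal)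
    show "relators \<subseteq> {x. Poly_Mapping.lookup x 0 = 0}"
      by (auto elim!: relators.cases
          simp: lookup_add lookup_minus constant_term_mult free_scale_def)
    show "two_sided_ideal {x :: free_alg. Poly_Mapping.lookup x 0 = 0}"
      by (simp add: two_sided_ideal_def lookup_add constant_term_mult)
  qed
  then show ?thesis by auto
qed

quotient_type alg_A = free_alg / "\<lambda>x y. x - y \<in> ideal_A"
proof (rule equivpI)
  show "reflp (\<lambda>x y. x - y \<in> ideal_A)"
    by (simp add: reflp_def ideal_A_closed)
  show "symp (\<lambda>x y. x - y \<in> ideal_A)"
    using ideal_A_closed(5) by (fastforce simp: symp_def)
  show "transp (\<lambda>x y. x - y \<in> ideal_A)"
    using ideal_A_closed(2) by (fastforce simp: transp_def)
qed

lemma ideal_A_mult_cong: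
  assumes "x - x' \<in> ideal_A" and "y - y' \<in> ideal_A"
  shows "x * y - x' * y' \<in> ideal_A"
proof -
  have "x * y - x' * y' = (x - x') * y + x' * (y - y')"
    by (simp add: algebra_simps)
  then show ?thesis using assms by (metis ideal_A_closed(2,3,4))
qed

instantiation alg_A :: ring_1
begin

lift_definition zero_alg_A :: alg_A is 0 .

lift_definition one_alg_A :: alg_A is 1 .

lift_definition plus_alg_A :: "alg_A \<Rightarrow> alg_A \<Rightarrow> alg_A" is "(+)"
proof -
  fix x x' y y' :: free_alg
  assume "x - x' \<in> ideal_A" "y - y' \<in> ideal_A"
  then show "x + y - (x' + y') \<in> ideal_A"
    using ideal_A_closed(2) by (simp add: add_diff_add)
qed

lift_definition minus_alg_A :: "alg_A \<Rightarrow> alg_A \<Rightarrow> alg_A" is "(-)"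
proof -
  fix x x' y y' :: free_alg
  assume "x - x' \<in> ideal_A" "y - y' \<in> ideal_A"
  then have "(x - x') - (y - y') \<in> ideal_A"
    by (rule ideal_A_closed(6))
  then show "x - y - (x' - y') \<in> ideal_A"
    by (simp add: algebra_simps)
qed

lift_definition uminus_alg_A :: "alg_A \<Rightarrow> alg_A" is uminus
  using ideal_A_closed(5) by (fastforce simp: minus_diff_minus)

lift_definition times_alg_A :: "alg_A \<Rightarrow> alg_A \<Rightarrow> alg_A" is "(*)"
  by (rule ideal_A_mult_cong)

instance
proof
  show "(0 :: alg_A) \<noteq> 1"
    by transfer (use one_notin_ideal_A ideal_A_closed(5) in fastforce)
qed (transfer; simp add: algebra_simps ideal_A_closed)+

end

lift_definition scale_A :: "k \<Rightarrow> alg_A \<Rightarrow> alg_A" (infixr "*\<^sub>A" 75) is free_scale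
  unfolding free_scale_def by (rule ideal_A_mult_cong) (simp_all add: ideal_A_closed)

lift_definition O_A :: "free2 \<Rightarrow> alg_A" is "free_gen Lab_A" .
lift_definition O_B :: "free2 \<Rightarrow> alg_A" is "free_gen Lab_B" .

definition alg_automorphism :: "(alg_A \<Rightarrow> alg_A) \<Rightarrow> bool" where
  "alg_automorphism f \<longleftrightarrow>
     bij f \<and> f 1 = 1 \<and> (\<forall>x y. f (x + y) = f x + f y) \<and> (\<forall>x y. f (x * y) = f x * f y) \<and>
     (\<forall>c x. f (c *\<^sub>A x) = c *\<^sub>A f x)"

text \<open>
  The two automorphisms are introduced by definite description: nothing can be derived about
  them before existence and uniqueness of an automorphism with the given values on the
  generators has been established.
\<close>

definition aut_s :: "alg_A \<Rightarrow> alg_A" where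
  "aut_s = (THE f. alg_automorphism f \<and>
     (\<forall>g. f (O_A g) = O_B (\<sigma> g)) \<and>
     (\<forall>g. f (O_B g) = O_A (\<sigma> g)))"

definition aut_a :: "alg_A \<Rightarrow> alg_A" where
  "aut_a = (THE f. alg_automorphism f \<and>
     (\<forall>g. f (O_A g) = - (inverse (kap ^ 2) *\<^sub>A (O_A 1 * O_A (g * inverse gen_a) * O_A 1))) \<and>
     (\<forall>g. f (O_B g) = inverse kap *\<^sub>A
        (Q *\<^sub>A (O_A 1 * O_B (g * inverse gen_a))
         - inverse Q *\<^sub>A (O_B (g * inverse gen_a) * O_A 1))))"

end

theory Submission
  imports Defs
begin

text \<open>
  Dividing the generators by \<open>\<i> * kap\<close> turns the squares \<open>x 1 * x 1\<close> and \<open>y 1 * y 1\<close> into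
  commuting idempotents, with respect to which the algebra looks like the path algebra of a quiver
  on three vertices: the \<open>x g\<close> are invertible arrows between the vertices 1 and 2, the \<open>y g\<close> between
  2 and 3. The map \<open>a\<close> becomes \<open>x g \<mapsto> x 1 * x (g a\<^sup>-\<^sup>1) * x 1\<close>,
  \<open>y g \<mapsto> q * x 1 * y (g a\<^sup>-\<^sup>1) + q\<^sup>-\<^sup>1 * y (g a\<^sup>-\<^sup>1) * x 1\<close> with \<open>q = \<i> Q\<close>, which conjugates each
  relation at \<open>g\<close> into the same relation at \<open>g a\<^sup>-\<^sup>1\<close>, so both maps extend to endomorphisms.
  The cube of \<open>a s\<close> is evaluated on generators by \<open>R\<^sub>1\<^sub>0\<close> and \<open>R\<^sub>1\<^sub>1\<close>. Bijectivity needs no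
  separate inverse: it follows from \<open>s\<^sup>2 = (a s)\<^sup>3 = 1\<close>.
\<close>

section \<open>The free group on two generators\<close>

lemma free2_left_cancel: "inverse g * (g * h) = (h :: free2)"
  by (simp add: free2_left_inverse flip: mult.assoc)

text \<open>Evaluate \<open>inverse (inverse g) * (inverse g * g)\<close> in two ways, using left
  inverses only.\<close>

lemma free2_inverse_inverse: "inverse (inverse g) = (g :: free2)"
  by (metis free2_left_cancel free2_left_inverse mult_1_right)

lemma free2_right_inverse: "g * inverse g = (1 :: free2)"
  by (metis free2_inverse_inverse free2_left_inverse)

lemma free2_right_cancel: "g * (inverse g * h) = (h :: free2)"
  by (simp add: free2_right_inverse flip: mult.assoc)

lemma \<sigma>_inverse: "\<sigma> (inverse g) = inverse (\<sigma> g)"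
  by (metis \<sigma>_simps(3,4) free2_left_inverse free2_right_cancel mult.assoc mult_1_right)

lemmas free2_simps = mult.assoc free2_left_inverse free2_right_inverse free2_left_cancel
  free2_right_cancel free2_inverse_inverse \<sigma>_simps \<sigma>_inverse

section \<open>Normalised families of generators\<close>

text \<open>The common shape of \<open>R8\<close> to \<open>R11\<close> with all four labels left
  free. Exchanging \<open>x\<close> and \<open>y\<close> gives \<open>R9\<close> and
  \<open>R11\<close>, so each argument about the shape covers two relations.\<close>

definition cubic :: "(free2 \<Rightarrow> 'r::ring_1) \<Rightarrow> (free2 \<Rightarrow> 'r) \<Rightarrow> free2 \<Rightarrow> free2 \<Rightarrow> free2 \<Rightarrow> free2 \<Rightarrow> bool"
  where "cubic x y h k m n \<longleftrightarrow>
    x h * x k * y m + y m * x k * x h = y h * y n * y h"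

text \<open>
  The defining relations for \<open>x g = O_A g / (\<i> * kap)\<close> and \<open>y g = O_B g / (\<i> * kap)\<close>:
  since \<open>(\<i> * kap)\<^sup>2 = - kap\<^sup>2\<close>, no scalars remain.
\<close>

locale normalized_family =
  fixes x y :: "free2 \<Rightarrow> 'r::ring_1"
  assumes x_a: "x (gen_a * g) = x g"
    and y_b: "y (gen_b * g) = y g"
    and xx: "x g * x g = x 1 * x 1"
    and yy: "y g * y g = y 1 * y 1"
    and yxy: "y g1 * x g2 * y g3 = 0"
    and xyx: "x g1 * y g2 * x g3 = 0"
    and x_unit_left: "x 1 * x 1 * x g = x g"
    and x_unit_right: "x g * x 1 * x 1 = x g"
    and y_unit_left: "y 1 * y 1 * y g = y g"
    and y_unit_right: "y g * y 1 * y 1 = y g"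
    and y_split: "x 1 * x 1 * y g + y g * x 1 * x 1 = y g"
    and x_split: "y 1 * y 1 * x g + x g * y 1 * y 1 = x g"
    and cubic_8: "cubic x y h (g * gen_a * gen_b * gen_a * h) (gen_a * h) (\<sigma> g * h)"
    and cubic_9: "cubic y x h (g * gen_b * gen_a * gen_b * h) (gen_b * h) (\<sigma> g * h)"
    and cubic_10: "cubic x y h (g * inverse gen_a * inverse gen_b * inverse gen_a * h)
      (inverse gen_a * h) (\<sigma> g * h)"
    and cubic_11: "cubic y x h (g * inverse gen_b * inverse gen_a * inverse gen_b * h)
      (inverse gen_b * h) (\<sigma> g * h)"

text \<open>This makes \<open>s\<close> well defined. Composing with \<sigma> exchanges the letters
  in every label, so \<open>cubic_8\<close> trades places with \<open>cubic_9\<close>, and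
  \<open>cubic_10\<close> with \<open>cubic_11\<close>.\<close>

lemma normalized_family_swap:
  assumes "normalized_family x y"
  shows "normalized_family (\<lambda>g. y (\<sigma> g)) (\<lambda>g. x (\<sigma> g))"
proof -
  interpret normalized_family x y by fact
  have c: "cubic (\<lambda>g. u (\<sigma> g)) (\<lambda>g. v (\<sigma> g)) h k m n"
    if "cubic u v (\<sigma> h) (\<sigma> k) (\<sigma> m) (\<sigma> n)" for u v :: "free2 \<Rightarrow> 'a" and h k m n
    using that by (simp add: cubic_def)
  show ?thesis
  proof
    show "cubic (\<lambda>g. y (\<sigma> g)) (\<lambda>g. x (\<sigma> g)) h (g * gen_a * gen_b * gen_a * h)
      (gen_a * h) (\<sigma> g * h)" for g h
      by (rule c) (use cubic_9[of "\<sigma> h" "\<sigma> g"] in \<open>simp add: \<sigma>_simps\<close>)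
    show "cubic (\<lambda>g. x (\<sigma> g)) (\<lambda>g. y (\<sigma> g)) h (g * gen_b * gen_a * gen_b * h)
      (gen_b * h) (\<sigma> g * h)" for g h
      by (rule c) (use cubic_8[of "\<sigma> h" "\<sigma> g"] in \<open>simp add: \<sigma>_simps\<close>)
    show "cubic (\<lambda>g. y (\<sigma> g)) (\<lambda>g. x (\<sigma> g)) h
      (g * inverse gen_a * inverse gen_b * inverse gen_a * h)
      (inverse gen_a * h) (\<sigma> g * h)" for g h
      by (rule c) (use cubic_11[of "\<sigma> h" "\<sigma> g"] in \<open>simp add: \<sigma>_simps \<sigma>_inverse\<close>)
    show "cubic (\<lambda>g. x (\<sigma> g)) (\<lambda>g. y (\<sigma> g)) h
      (g * inverse gen_b * inverse gen_a * inverse gen_b * h)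
      (inverse gen_b * h) (\<sigma> g * h)" for g h
      by (rule c) (use cubic_10[of "\<sigma> h" "\<sigma> g"] in \<open>simp add: \<sigma>_simps \<sigma>_inverse\<close>)
  qed (simp_all add: \<sigma>_simps x_a y_b yxy xyx x_unit_left x_unit_right y_unit_left y_unit_right
      x_split y_split, rule yy, rule xx)
qed

section \<open>Path calculus in the three-vertex quiver\<close>

context normalized_family
begin

lemma x_a_inverse: "x (inverse gen_a * g) = x g"
  by (metis x_a free2_right_cancel)

lemma y_b_inverse: "y (inverse gen_b * g) = y g"
  by (metis y_b free2_right_cancel)

lemma x_a_inverse_one: "x (inverse gen_a) = x 1"
  using x_a_inverse[of 1] by simp

lemma zero_assoc:
  "y g1 * (x g2 * y g3) = 0" "x g1 * (y g2 * x g3) = 0"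
  "y g1 * (x g2 * (y g3 * z)) = 0" "x g1 * (y g2 * (x g3 * z)) = 0"
  using yxy[of g1 g2 g3] xyx[of g1 g2 g3]
  by (metis mult.assoc mult_zero_left)+

lemma xx_cancel:
  "x g * (x g * x h) = x h" "x h * (x g * x g) = x h"
  "x g * (x g * (x h * z)) = x h * z" "x h * (x g * (x g * z)) = x h * z"
proof -
  show 1: "x g * (x g * x h) = x h" for h by (metis mult.assoc xx x_unit_left)
  show 2: "x h * (x g * x g) = x h" by (metis mult.assoc xx x_unit_right)
  show "x g * (x g * (x h * z)) = x h * z" using 1 by (metis mult.assoc)
  show "x h * (x g * (x g * z)) = x h * z" using 2 by (metis mult.assoc)
qed

lemma yy_cancel:
  "y g * (y g * y h) = y h" "y h * (y g * y g) = y h"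
  "y g * (y g * (y h * z)) = y h * z" "y h * (y g * (y g * z)) = y h * z"
proof -
  show 1: "y g * (y g * y h) = y h" for h by (metis mult.assoc yy y_unit_left)
  show 2: "y h * (y g * y g) = y h" by (metis mult.assoc yy y_unit_right)
  show "y g * (y g * (y h * z)) = y h * z" using 1 by (metis mult.assoc)
  show "y h * (y g * (y g * z)) = y h * z" using 2 by (metis mult.assoc)
qed

text \<open>Moving the idempotent \<open>x 1 * x 1\<close> across a \<open>y\<close> turns it into
  its complement. Any square \<open>x k * x k\<close> may stand for it, since all these squares
  agree.\<close>

lemma y_split': "x k * (x k * y g) = y g - y g * (x 1 * x 1)"
  using y_split[of g] xx[of k] by (metis add_diff_cancel_right' mult.assoc)

lemma x_split': "y k * (y k * x g) = x g - x g * (y 1 * y 1)"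
  using x_split[of g] yy[of k] by (metis add_diff_cancel_right' mult.assoc)

text \<open>Crossing one \<open>y\<close> complements the idempotent \<open>x 1 * x 1\<close>;
  crossing two restores it.\<close>

lemma yy_commute: "x 1 * (x 1 * (y h * y k)) = y h * (y k * (x 1 * x 1))"
proof -
  have "x 1 * (x 1 * (y h * y k)) = (y h - y h * (x 1 * x 1)) * y k"
    by (simp add: y_split'[of 1, symmetric] mult.assoc)
  also have "\<dots> = y h * (y k - x 1 * (x 1 * y k))"
    by (simp add: algebra_simps)
  also have "\<dots> = y h * (y k * (x 1 * x 1))"
    by (simp add: y_split')
  finally show ?thesis .
qed

lemma xx_commute: "y 1 * (y 1 * (x h * x k)) = x h * (x k * (y 1 * y 1))"
proof -
  have "y 1 * (y 1 * (x h * x k)) = (x h - x h * (y 1 * y 1)) * x k"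
    by (simp add: x_split'[of 1, symmetric] mult.assoc)
  also have "\<dots> = x h * (x k - y 1 * (y 1 * x k))"
    by (simp add: algebra_simps)
  also have "\<dots> = x h * (x k * (y 1 * y 1))"
    by (simp add: x_split')
  finally show ?thesis .
qed

text \<open>Three arrows \<open>y\<close> starting at vertex 2 end at vertex 3, where no
  \<open>x\<close> is attached. Algebraically, an idempotent inserted after \<open>x g\<close> moves
  across two factors \<open>y\<close> and meets \<open>y l * x m\<close>, where
  \<open>x 1 * (y l * x m) = 0\<close>.\<close>

lemma xyyyx_assoc:
  "x g * (y h * (y k * (y l * x m))) = 0" "x g * (y h * (y k * (y l * (x m * z)))) = 0"
proof -
  have "x g * (y h * (y k * (y l * x m))) = x g * (x 1 * (x 1 * (y h * y k))) * (y l * x m)"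
    by (simp add: mult.assoc xx_cancel)
  also have "\<dots> = 0"
    unfolding yy_commute by (simp add: mult.assoc zero_assoc)
  finally show "x g * (y h * (y k * (y l * x m))) = 0" .
  then show "x g * (y h * (y k * (y l * (x m * z)))) = 0"
    by (metis mult.assoc mult_zero_left)
qed

lemma yxxxy_assoc:
  "y g * (x h * (x k * (x l * y m))) = 0" "y g * (x h * (x k * (x l * (y m * z)))) = 0"
proof -
  have "y g * (x h * (x k * (x l * y m))) = y g * (y 1 * (y 1 * (x h * x k))) * (x l * y m)"
    by (simp add: mult.assoc yy_cancel)
  also have "\<dots> = 0"
    unfolding xx_commute by (simp add: mult.assoc zero_assoc)
  finally show "y g * (x h * (x k * (x l * y m))) = 0" .
  then show "y g * (x h * (x k * (x l * (y m * z)))) = 0"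
    by (metis mult.assoc mult_zero_left)
qed

text \<open>Rewriting of right-associated monomials; the variants with a trailing \<open>z\<close>
  reach patterns in the middle of a product.\<close>

lemmas assoc_simps = mult.assoc zero_assoc xx_cancel yy_cancel xyyyx_assoc yxxxy_assoc
  distrib_left distrib_right

text \<open>The instance is chosen so that the middle label on the right becomes a free
  \<open>g\<close>: \<sigma> turns \<open>gen_b * gen_a\<close> into \<open>gen_a * gen_b\<close>,
  which cancels against \<open>inverse gen_b * inverse gen_a\<close>.\<close>

lemma cubic_10':
  "cubic x y (inverse gen_b * inverse gen_a)
    (\<sigma> g * inverse gen_a * inverse gen_b * inverse gen_a) (inverse gen_a * inverse gen_b * inverse gen_a) g"
  using cubic_10[of "inverse gen_b * inverse gen_a" "\<sigma> g * gen_b * gen_a"]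
  by (simp add: free2_simps)

lemma cubic_11':
  "cubic y x (inverse gen_a)
    (\<sigma> g * inverse gen_a * inverse gen_b * inverse gen_a) (inverse gen_b * inverse gen_a) g"
  using cubic_11[of "inverse gen_a" "\<sigma> g * gen_b"]
  by (simp add: free2_simps)

end

section \<open>Effect of \<open>a\<close> on a normalised family\<close>

locale twisted_family = normalized_family x y for x y :: "free2 \<Rightarrow> 'r::ring_1" +
  fixes q q' :: 'r
  assumes q_q': "q * q' = 1"
    and q_central: "z * q = q * z"
    and q'_central: "z * q' = q' * z"
begin

text \<open>The images of \<open>x\<close> and \<open>y\<close> under the automorphism \<open>a\<close>.\<close>

definition xt :: "free2 \<Rightarrow> 'r" where
  "xt g = x 1 * x (g * inverse gen_a) * x 1"

definition yt :: "free2 \<Rightarrow> 'r" where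
  "yt g = q * x 1 * y (g * inverse gen_a) + q' * y (g * inverse gen_a) * x 1"

lemma central_simps:
  "x g * q = q * x g" "y g * q = q * y g" "x g * q' = q' * x g" "y g * q' = q' * y g"
  "x g * (q * z) = q * (x g * z)" "y g * (q * z) = q * (y g * z)"
  "x g * (q' * z) = q' * (x g * z)" "y g * (q' * z) = q' * (y g * z)"
  "q' * q = 1" "q * (q' * z) = z" "q' * (q * z) = z"
  using q_q' q_central q'_central by (metis mult.assoc mult_1_left)+

lemmas twist_simps = assoc_simps q_q' central_simps

text \<open>The terms with \<open>q * q\<close> or \<open>q' * q'\<close> contain a vanishing
  \<open>x\<close>-\<open>y\<close>-\<open>x\<close> pattern; in the mixed terms the scalars
  cancel.\<close>

lemma yt_yt: "yt g * yt h = x 1 * y (g * inverse gen_a) * y (h * inverse gen_a) * x 1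
    + y (g * inverse gen_a) * x 1 * x 1 * y (h * inverse gen_a)"
  by (simp add: yt_def twist_simps)

text \<open>\<open>y_split'\<close> moves the idempotent left inside by \<open>yt_yt\<close> across
  the next \<open>y\<close>; the correction terms contain
  \<open>x\<close>-\<open>y\<close>-\<open>y\<close>-\<open>y\<close>-\<open>x\<close> or
  \<open>x\<close>-\<open>y\<close>-\<open>x\<close> and vanish.\<close>

lemma yt_yt_yt: "yt g * yt h * yt k =
    q * x 1 * y (g * inverse gen_a) * y (h * inverse gen_a) * y (k * inverse gen_a)
    + q' * y (g * inverse gen_a) * y (h * inverse gen_a) * y (k * inverse gen_a) * x 1"
  by (simp add: yt_yt) (simp add: yt_def twist_simps y_split' right_diff_distrib left_diff_distrib)

text \<open>Both sides are the sides of the relation at the shifted labels, multiplied by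
  \<open>x 1\<close> on the left with weight \<open>q\<close> and on the right with weight
  \<open>q'\<close>.\<close>

lemma cubic_xt_yt:
  assumes "cubic x y (h * inverse gen_a) (k * inverse gen_a) (m * inverse gen_a) (n * inverse gen_a)"
  shows "cubic xt yt h k m n"
proof -
  let ?x = "\<lambda>g. x (g * inverse gen_a)" and ?y = "\<lambda>g. y (g * inverse gen_a)"
  have c: "?x h * ?x k * ?y m + ?y m * ?x k * ?x h = ?y h * ?y n * ?y h"
    using assms by (simp add: cubic_def)
  have "xt h * xt k * yt m + yt m * xt k * xt h
    = q * x 1 * (?x h * ?x k * ?y m + ?y m * ?x k * ?x h)
      + q' * (?x h * ?x k * ?y m + ?y m * ?x k * ?x h) * x 1"
    by (simp add: xt_def yt_def twist_simps)
  also have "\<dots> = yt h * yt n * yt h"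
    unfolding c yt_yt_yt by (simp add: mult.assoc)
  finally show ?thesis by (simp add: cubic_def)
qed

lemma cubic_yt_xt:
  assumes "cubic y x (h * inverse gen_a) (k * inverse gen_a) (m * inverse gen_a) (n * inverse gen_a)"
  shows "cubic yt xt h k m n"
proof -
  let ?x = "\<lambda>g. x (g * inverse gen_a)" and ?y = "\<lambda>g. y (g * inverse gen_a)"
  have c: "?y h * ?y k * ?x m + ?x m * ?y k * ?y h = ?x h * ?x n * ?x h"
    using assms by (simp add: cubic_def)
  have "yt h * yt k * xt m + xt m * yt k * yt h
    = x 1 * (?y h * ?y k * ?x m + ?x m * ?y k * ?y h) * x 1"
    by (simp add: xt_def yt_def twist_simps)
  also have "\<dots> = xt h * xt n * xt h"
    unfolding c by (simp add: xt_def twist_simps)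
  finally show ?thesis by (simp add: cubic_def)
qed

lemma normalized_family_twist: "normalized_family xt yt"
proof
  fix g g1 g2 g3 h
  have xt_1: "xt 1 = x 1"
    by (simp add: xt_def x_a_inverse_one twist_simps)
  show "xt (gen_a * g) = xt g" "yt (gen_b * g) = yt g"
    by (simp_all add: xt_def yt_def mult.assoc x_a y_b)
  show "xt g * xt g = xt 1 * xt 1"
    unfolding xt_1 by (simp add: xt_def twist_simps)
  \<comment> \<open>The right-hand side is free of the label. It is the idempotent of vertices 1 and
    3: the twist exchanges vertices 1 and 2, so the twisted \<open>y\<close> runs between 1 and
    3.\<close>
  have yt_sq: "yt g * yt g = x 1 * (y 1 * y 1) * x 1 + (y 1 * y 1 - y 1 * y 1 * (x 1 * x 1))" for g
    using yy[of "g * inverse gen_a"]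
    by (simp add: yt_yt mult.assoc y_split' right_diff_distrib) (simp flip: mult.assoc)
  then show "yt g * yt g = yt 1 * yt 1" by simp
  show "yt g1 * xt g2 * yt g3 = 0" "xt g1 * yt g2 * xt g3 = 0"
    by (simp_all add: xt_def yt_def twist_simps)
  show "xt 1 * xt 1 * xt g = xt g" "xt g * xt 1 * xt 1 = xt g"
    unfolding xt_1 by (simp_all add: xt_def twist_simps)
  show "yt 1 * yt 1 * yt g = yt g" "yt g * yt 1 * yt 1 = yt g"
    unfolding yt_yt_yt by (simp_all add: yt_def twist_simps)
  show "xt 1 * xt 1 * yt g + yt g * xt 1 * xt 1 = yt g"
    unfolding xt_1 by (simp add: yt_def twist_simps)
  \<comment> \<open>The difference in \<open>yt_sq\<close> annihilates \<open>xt g\<close> from both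
    sides, on the right because the two idempotents commute.\<close>
  have "yt 1 * yt 1 * xt g + xt g * yt 1 * yt 1
    = x 1 * (y 1 * y 1 * x (g * inverse gen_a) + x (g * inverse gen_a) * y 1 * y 1) * x 1"
    by (simp add: mult.assoc[of "xt g"] yt_sq)
      (simp add: xt_def twist_simps right_diff_distrib left_diff_distrib,
        simp add: yy_commute[symmetric] xx_cancel)
  also have "\<dots> = xt g"
    by (simp add: x_split xt_def)
  finally show "yt 1 * yt 1 * xt g + xt g * yt 1 * yt 1 = xt g" .
  show "cubic xt yt h (g * gen_a * gen_b * gen_a * h) (gen_a * h) (\<sigma> g * h)"
    by (rule cubic_xt_yt) (use cubic_8 in \<open>simp add: mult.assoc\<close>)
  show "cubic yt xt h (g * gen_b * gen_a * gen_b * h) (gen_b * h) (\<sigma> g * h)"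
    by (rule cubic_yt_xt) (use cubic_9 in \<open>simp add: mult.assoc\<close>)
  show "cubic xt yt h (g * inverse gen_a * inverse gen_b * inverse gen_a * h)
      (inverse gen_a * h) (\<sigma> g * h)"
    by (rule cubic_xt_yt) (use cubic_10 in \<open>simp add: mult.assoc\<close>)
  show "cubic yt xt h (g * inverse gen_b * inverse gen_a * inverse gen_b * h)
      (inverse gen_b * h) (\<sigma> g * h)"
    by (rule cubic_yt_xt) (use cubic_11 in \<open>simp add: mult.assoc\<close>)
qed

text \<open>The values of \<open>t\<close> are those of \<open>a s\<close>. Applying
  \<open>t\<close> three times to \<open>x g\<close> produces the left side of \<open>R11\<close>
  between two factors \<open>x 1\<close>; for \<open>y g\<close> it produces that of
  \<open>R10\<close> between two factors \<open>y\<close>, once \<open>x 1\<close> is expanded by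
  \<open>R11\<close>.\<close>

lemma order_three:
  fixes t :: "'r \<Rightarrow> 'r"
  assumes add: "\<And>u v. t (u + v) = t u + t v" and mult: "\<And>u v. t (u * v) = t u * t v"
    and q: "t q = q" "t q' = q'"
    and x: "\<And>g. t (x g) = yt (\<sigma> g)" and y: "\<And>g. t (y g) = xt (\<sigma> g)"
  shows "t (t (t (x g))) = x g" and "t (t (t (y g))) = y g"
proof -
  let ?a = "inverse gen_a" and ?b = "inverse gen_b"
  let ?u = "x (?b * ?a)" and ?v = "y ?a" and ?w = "y (?a * (?b * ?a))"
  have tx: "t (x g) = q * x 1 * y (\<sigma> g * ?a) + q' * y (\<sigma> g * ?a) * x 1" for g
    by (simp add: x yt_def)
  have ty: "t (y g) = x 1 * x (\<sigma> g * ?a) * x 1" for g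
    by (simp add: y xt_def)
  \<comment> \<open>Here \<open>t (x 1)\<close> carries its own \<open>q\<close> and
    \<open>q'\<close>; only terms where these cancel the outer scalars survive.\<close>
  have ttx: "t (t (x g)) = y ?a * x (g * ?b * ?a) * x 1 + x 1 * x (g * ?b * ?a) * y ?a" for g
  proof -
    have "t (t (x g)) = q * t (x 1) * t (y (\<sigma> g * ?a)) + q' * t (y (\<sigma> g * ?a)) * t (x 1)"
      by (subst tx) (simp add: add mult q)
    then show ?thesis
      unfolding tx ty by (simp add: twist_simps free2_simps)
  qed
  have tty: "t (t (y g)) = q * x 1 * ?v * y (g * ?b * ?a) * ?v + q' * ?v * y (g * ?b * ?a) * ?v * x 1"
    for g
  proof -
    have "t (t (y g)) = yt 1 * yt (g * ?b) * yt 1"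
      by (subst ty) (simp add: mult x free2_simps)
    then show ?thesis
      by (simp add: yt_yt_yt)
  qed
  have R11: "?v * y (\<sigma> g * ?a * ?b * ?a) * ?u + ?u * y (\<sigma> g * ?a * ?b * ?a) * ?v = x 1 * x g * x 1" for g
    using cubic_11'[of g] by (simp add: cubic_def x_a_inverse_one)
  have R10: "?u * x (\<sigma> g * ?a * ?b * ?a) * ?w + ?w * x (\<sigma> g * ?a * ?b * ?a) * ?u = ?v * y g * ?v"
    using cubic_10'[of g] by (simp add: cubic_def y_b_inverse mult.assoc)
  show "t (t (t (x g))) = x g"
  proof -
    let ?k = "y (\<sigma> g * ?a * ?b * ?a)"
    have "t (t (t (x g))) = t ?v * t (x (g * ?b * ?a)) * t (x 1)
        + t (x 1) * t (x (g * ?b * ?a)) * t ?v"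
      by (simp add: ttx add mult)
    also have "\<dots> = x 1 * (?v * ?k * ?u + ?u * ?k * ?v) * x 1"
      unfolding tx ty by (simp add: twist_simps free2_simps)
    also have "\<dots> = x g"
      unfolding R11 by (simp add: twist_simps)
    finally show ?thesis .
  qed
  show "t (t (t (y g))) = y g"
  proof -
    let ?k = "x (\<sigma> g * ?a * ?b * ?a)"
    \<comment> \<open>\<open>R11\<close> at the trivial label, whose right side is the cube of
      \<open>x 1\<close>.\<close>
    have x1: "x 1 = ?v * ?w * ?u + ?u * ?w * ?v"
      using R11[of 1] by (simp add: mult.assoc \<sigma>_simps xx_cancel)
    have "t (t (t (y g))) = q * t (x 1) * t ?v * t (y (g * ?b * ?a)) * t ?v
        + q' * t ?v * t (y (g * ?b * ?a)) * t ?v * t (x 1)"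
      by (simp add: tty add mult q)
    also have "\<dots> = ?v * ?u * ?k * ?u * x 1 + x 1 * ?u * ?k * ?u * ?v"
      unfolding tx ty by (simp add: twist_simps free2_simps)
    \<comment> \<open>In each product one summand of \<open>x 1\<close> creates a zero pattern
      \<open>y\<close>-\<open>x\<close>-\<open>x\<close>-\<open>x\<close>-\<open>y\<close>; in the
      other the square of \<open>?u\<close> cancels.\<close>
    also have "\<dots> = ?v * (?u * ?k * ?w + ?w * ?k * ?u) * ?v"
      by (subst (1 2) x1) (simp add: twist_simps add.commute)
    also have "\<dots> = y g"
      unfolding R10 by (simp add: twist_simps)
    finally show ?thesis .
  qed
qed

end

section \<open>Homomorphisms out of the algebra\<close>

lemma poly_mapping_add_induct [case_names zero add]:
  assumes "P 0" and "\<And>p w c. P p \<Longrightarrow> P (p + Poly_Mapping.single w c)"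
  shows "P (p :: 'a \<Rightarrow>\<^sub>0 'b::monoid_add)"
proof (induction p rule: update_induct)
  case const
  then show ?case by (rule assms(1))
next
  case (update f a b)
  have "Poly_Mapping.update a b f = f + Poly_Mapping.single a b"
    using update.hyps(1)
    by (intro poly_mapping_eqI) (auto simp: lookup_update lookup_add lookup_single when_def in_keys_iff)
  with assms(2)[OF update.IH] show ?case by simp
qed

lemma single_zero_central:
  fixes p :: "'a::monoid_add \<Rightarrow>\<^sub>0 'c::comm_semiring_1"
  shows "Poly_Mapping.single 0 c * p = p * Poly_Mapping.single 0 c"
  by (induction p rule: poly_mapping_add_induct) (simp_all add: algebra_simps mult_single)

section \<open>Scalars as central elements of the algebra\<close>

definition emb :: "k \<Rightarrow> alg_A" where "emb c = c *\<^sub>A 1"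

lemma scale_A_eq: "c *\<^sub>A z = emb c * z"
  unfolding emb_def by transfer (simp add: free_scale_def ideal_A_closed)

lemma emb_central: "z * emb c = emb c * z"
  unfolding emb_def
  by transfer (simp add: free_scale_def ideal_A_closed single_zero_central)

lemma emb_left_commute: "z * (emb c * z') = emb c * (z * z')"
  by (simp add: emb_central flip: mult.assoc)

lemma emb_add: "emb (c + d) = emb c + emb d"
  unfolding emb_def by transfer (simp add: free_scale_def ideal_A_closed single_add)

lemma emb_mult: "emb (c * d) = emb c * emb d"
  unfolding emb_def by transfer (simp add: free_scale_def ideal_A_closed mult_single)

lemma emb_0: "emb 0 = 0"
  using emb_add[of 0 0] by simp

lemma emb_1: "emb 1 = 1"
  unfolding emb_def by transfer (simp add: free_scale_def ideal_A_closed)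

lemma emb_minus: "emb (- c) = - emb c"
  using emb_add[of c "- c"] by (simp add: emb_0 add_eq_0_iff)

lemma emb_inverse:
  assumes "c \<noteq> 0"
  shows "emb c * emb (inverse c) = 1" "emb (inverse c) * emb c = 1"
  using assms by (simp_all add: emb_1 flip: emb_mult)

section \<open>Evaluation of noncommutative polynomials\<close>

definition word_eval :: "('x \<Rightarrow> alg_A) \<Rightarrow> ('x word \<Rightarrow>\<^sub>0 k) \<Rightarrow> alg_A" where
  "word_eval F p = (\<Sum>w\<in>Poly_Mapping.keys p.
     emb (Poly_Mapping.lookup p w) * prod_list (map F (letters w)))"

lemma word_eval_0: "word_eval F 0 = 0"
  by (simp add: word_eval_def)

lemma word_eval_single:
  "word_eval F (Poly_Mapping.single w c) = emb c * prod_list (map F (letters w))"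
  by (cases "c = 0") (simp_all add: word_eval_def emb_0)

lemma word_eval_1: "word_eval F 1 = 1"
  using word_eval_single[of F 0 1] unfolding single_one by (simp add: emb_1 zero_word_def)

lemma word_eval_add: "word_eval F (p + q) = word_eval F p + word_eval F q"
  unfolding word_eval_def
  by (rule setsum_keys_plus_distrib) (simp_all add: emb_0 emb_add distrib_right)

lemma word_eval_minus: "word_eval F (p - q) = word_eval F p - word_eval F q"
  using word_eval_add[of F "p - q" q] by simp

lemma word_eval_mult: "word_eval F (p * q) = word_eval F p * word_eval F q"
proof (induction p rule: poly_mapping_add_induct)
  case zero
  show ?case by (simp add: word_eval_0)
next
  case (add p w c)
  have "word_eval F (Poly_Mapping.single w c * q)
    = word_eval F (Poly_Mapping.single w c) * word_eval F q"
  proof (induction q rule: poly_mapping_add_induct)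
    case zero
    show ?case by (simp add: word_eval_0)
  next
    case (add q v d)
    have "word_eval F (Poly_Mapping.single w c * Poly_Mapping.single v d)
      = word_eval F (Poly_Mapping.single w c) * word_eval F (Poly_Mapping.single v d)"
      by (simp add: mult_single word_eval_single plus_word_def emb_mult mult.assoc
          emb_left_commute[of "prod_list _"])
    with add show ?case by (simp add: word_eval_add distrib_left)
  qed
  with add show ?case by (simp add: word_eval_add distrib_right)
qed

lemma word_eval_free_gen: "word_eval F (free_gen X g) = F (X, g)"
  by (simp add: free_gen_def word_eval_single emb_1)

lemma word_eval_scale: "word_eval F (c *\<^sub>F p) = emb c * word_eval F p"
  by (simp add: free_scale_def word_eval_mult word_eval_single zero_word_def)

lemmas word_eval_simps = word_eval_add word_eval_minus word_eval_mult word_eval_free_gen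
  word_eval_scale

definition alg_hom :: "(alg_A \<Rightarrow> alg_A) \<Rightarrow> bool" where
  "alg_hom f \<longleftrightarrow> f 1 = 1 \<and> (\<forall>x y. f (x + y) = f x + f y) \<and> (\<forall>x y. f (x * y) = f x * f y) \<and>
     (\<forall>c x. f (c *\<^sub>A x) = c *\<^sub>A f x)"

lemma alg_hom_simps:
  assumes "alg_hom f"
  shows "f 1 = 1" "f (x + y) = f x + f y" "f (x * y) = f x * f y" "f (c *\<^sub>A x) = c *\<^sub>A f x"
    "f (emb c) = emb c"
  using assms by (simp_all add: alg_hom_def emb_def)

lemma alg_hom_comp: "alg_hom f \<Longrightarrow> alg_hom g \<Longrightarrow> alg_hom (f \<circ> g)"
  by (simp add: alg_hom_def)

lemma alg_hom_id: "alg_hom id"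
  by (simp add: alg_hom_def)

lemma alg_A_exhaust: "\<exists>p. z = abs_alg_A p"
  by (induction z rule: alg_A.abs_induct) blast

text \<open>The kernel of an evaluation is a two-sided ideal, so it contains the hull of the
  relators once it contains the relators.\<close>

lemma ex_alg_hom:
  assumes "\<And>r. r \<in> relators \<Longrightarrow> word_eval F r = 0"
  shows "\<exists>f. alg_hom f \<and> (\<forall>g. f (O_A g) = F (Lab_A, g)) \<and> (\<forall>g. f (O_B g) = F (Lab_B, g))"
proof -
  have "ideal_A \<subseteq> {p. word_eval F p = 0}"
    unfolding ideal_A_def
    by (rule hull_minimal)
      (auto simp: assms two_sided_ideal_def word_eval_0 word_eval_add word_eval_mult)
  then have vanish: "word_eval F p = word_eval F p'" if "p - p' \<in> ideal_A" for p p'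
    using that by (auto simp: word_eval_minus)
  \<comment> \<open>\<open>rep_alg_A\<close> picks some representative; \<open>vanish\<close> makes
    the value independent of the choice.\<close>
  define f where "f z = word_eval F (rep_alg_A z)" for z
  have f_abs: "f (abs_alg_A p) = word_eval F p" for p
    unfolding f_def
    by (rule vanish) (simp add: Quotient3_abs_rep[OF Quotient3_alg_A] flip: alg_A.abs_eq_iff)
  have "f 1 = 1"
    by (simp add: one_alg_A.abs_eq f_abs word_eval_1[unfolded one_alg_A.abs_eq])
  moreover have "f (x + y) = f x + f y" "f (x * y) = f x * f y" "f (c *\<^sub>A x) = c *\<^sub>A f x"
    for c x y
  proof -
    obtain p q where "x = abs_alg_A p" "y = abs_alg_A q"
      using alg_A_exhaust by meson
    then show "f (x + y) = f x + f y" "f (x * y) = f x * f y" "f (c *\<^sub>A x) = c *\<^sub>A f x"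
      by (simp_all only: plus_alg_A.abs_eq times_alg_A.abs_eq scale_A.abs_eq f_abs
          word_eval_add word_eval_mult word_eval_scale scale_A_eq[of _ "word_eval F _"])
  qed
  moreover have "f (O_A g) = F (Lab_A, g)" "f (O_B g) = F (Lab_B, g)" for g
    by (simp_all add: O_A.abs_eq O_B.abs_eq f_abs word_eval_simps)
  ultimately show ?thesis by (auto simp: alg_hom_def)
qed

text \<open>Monomials are products of generators, and their scalar multiples span the
  algebra.\<close>

lemma alg_hom_eqI:
  assumes f: "alg_hom f" and f': "alg_hom f'"
    and "\<And>g. f (O_A g) = f' (O_A g)" "\<And>g. f (O_B g) = f' (O_B g)"
  shows "f = f'"
proof
  have gen: "f (abs_alg_A (free_gen X g)) = f' (abs_alg_A (free_gen X g))" for X g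
    using assms(3,4)[of g] by (cases X) (simp_all add: O_A.abs_eq O_B.abs_eq)
  have word: "f (abs_alg_A (Poly_Mapping.single (Word w) 1))
      = f' (abs_alg_A (Poly_Mapping.single (Word w) 1))" for w
  proof (induction w)
    case Nil
    have "abs_alg_A (Poly_Mapping.single (Word []) 1) = 1"
      by (simp add: one_alg_A.abs_eq flip: zero_word_def)
    then show ?case using f f' by (simp add: alg_hom_simps)
  next
    case (Cons l w)
    obtain X g where l: "l = (X, g)" by (cases l)
    have "abs_alg_A (Poly_Mapping.single (Word (l # w)) 1)
      = abs_alg_A (free_gen X g) * abs_alg_A (Poly_Mapping.single (Word w) 1)"
      by (simp add: times_alg_A.abs_eq free_gen_def mult_single plus_word_def l)
    then show ?case using f f' Cons.IH gen by (simp add: alg_hom_simps)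
  qed
  have abs: "f (abs_alg_A p) = f' (abs_alg_A p)" for p
  proof (induction p rule: poly_mapping_add_induct)
    case zero
    have "abs_alg_A 0 = 0 *\<^sub>A 1" by (simp add: scale_A_eq emb_0 zero_alg_A.abs_eq)
    then show ?case using f f' by (simp only: alg_hom_simps)
  next
    case (add p w c)
    have "abs_alg_A (p + Poly_Mapping.single w c)
      = abs_alg_A p + c *\<^sub>A abs_alg_A (Poly_Mapping.single w 1)"
      by (simp add: plus_alg_A.abs_eq scale_A.abs_eq free_scale_def mult_single)
    then show ?case using f f' add.IH word[of "letters w"] by (simp add: alg_hom_simps)
  qed
  show "f z = f' z" for z using abs alg_A_exhaust[of z] by auto
qed

section \<open>The normalised generators\<close>

definition imag :: k where "imag = Fraction_Field.Fract [:\<i>:] 1"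

lemma imag_imag: "imag * imag = - 1"
  by (simp add: imag_def One_fract_def one_pCons)

lemma Q_nonzero: "Q \<noteq> 0"
  by (simp add: Q_def Zero_fract_def eq_fract)

lemma kap_nonzero: "kap \<noteq> 0"
proof
  assume "kap = 0"
  \<comment> \<open>Impossible for an indeterminate: a monomial of degree 4 would equal a
    constant.\<close>
  then have "Q ^ 2 * Q ^ 2 = 1"
    using Q_nonzero by (simp add: kap_def field_simps)
  then show False
    by (simp add: Q_def One_fract_def eq_fract power2_eq_square one_pCons)
qed

lemma imag_nonzero: "imag \<noteq> 0"
  using imag_imag by auto

definition \<theta> :: alg_A where "\<theta> = emb (imag * kap)"
definition \<theta>' :: alg_A where "\<theta>' = emb (inverse (imag * kap))"

lemma \<theta>_central: "z * \<theta> = \<theta> * z" "z * \<theta>' = \<theta>' * z"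
  by (simp_all add: \<theta>_def \<theta>'_def emb_central)

lemma \<theta>_inverse: "\<theta> * \<theta>' = 1" "\<theta>' * \<theta> = 1"
  unfolding \<theta>_def \<theta>'_def by (rule emb_inverse; simp add: kap_nonzero imag_nonzero)+

lemma \<theta>_inverse_assoc: "\<theta> * (\<theta>' * z) = z" "\<theta>' * (\<theta> * z) = z"
  by (simp_all add: \<theta>_inverse flip: mult.assoc)

lemma emb_kap_sq: "emb (kap ^ 2) = - (\<theta> * \<theta>)"
proof -
  have "kap ^ 2 = - ((imag * kap) * (imag * kap))"
    using imag_imag by (simp add: power2_eq_square algebra_simps)
  then show ?thesis by (simp only: \<theta>_def emb_mult emb_minus)
qed

text \<open>Each relator becomes a power of the central \<theta> times a normalised relation; in the
  inhomogeneous ones \<open>kap ^ 2\<close> supplies the two missing factors \<theta>, with a minus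
  sign.\<close>

lemma relators_vanish:
  assumes "normalized_family x y" "r \<in> relators"
    and FA: "\<And>g. F (Lab_A, g) = \<theta> * x g" and FB: "\<And>g. F (Lab_B, g) = \<theta> * y g"
  shows "word_eval F r = 0"
proof -
  interpret normalized_family x y by fact
  have cx: "x g * \<theta> = \<theta> * x g" "x g * (\<theta> * z) = \<theta> * (x g * z)"
    and cy: "y g * \<theta> = \<theta> * y g" "y g * (\<theta> * z) = \<theta> * (y g * z)" for g z
    by (metis \<theta>_central(1) mult.assoc)+
  have cub: "u h * (u k * v m) + v m * (u k * u h) = v h * (v n * v h)"
    if "cubic u v h k m n" for u v :: "free2 \<Rightarrow> alg_A" and h k m n
    using that by (simp add: cubic_def mult.assoc)
  note simps = word_eval_simps FA FB mult.assoc cx cy emb_kap_sq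
  note F = cub[OF cubic_8] cub[OF cubic_9] cub[OF cubic_10] cub[OF cubic_11]
  show ?thesis
    using assms(2)
  proof cases
    case (R1 X g)
    then show ?thesis by (cases X) (simp_all add: simps xx[of g] yy[of g])
  next
    case (R4 X g)
    then show ?thesis by (cases X) (simp_all add: simps xx_cancel yy_cancel)
  next
    case (R5 X g)
    then show ?thesis by (cases X) (simp_all add: simps xx_cancel yy_cancel)
  next
    case (R8 g2 g1)
    then show ?thesis using F(1)[of g2 g1] by (simp add: simps flip: distrib_left)
  next
    case (R9 g2 g1)
    then show ?thesis using F(2)[of g2 g1] by (simp add: simps flip: distrib_left)
  next
    case (R10 g2 g1)
    then show ?thesis using F(3)[of g2 g1] by (simp add: simps flip: distrib_left)
  next
    case (R11 g2 g1)
    then show ?thesis using F(4)[of g2 g1] by (simp add: simps flip: distrib_left)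
  qed (simp_all add: simps x_a y_b zero_assoc x_split' y_split' right_diff_distrib)
qed

section \<open>The rescaled generators form a normalised family\<close>

definition xA :: "free2 \<Rightarrow> alg_A" where "xA g = \<theta>' * O_A g"
definition yA :: "free2 \<Rightarrow> alg_A" where "yA g = \<theta>' * O_B g"

lemma O_A_eq: "O_A g = \<theta> * xA g" and O_B_eq: "O_B g = \<theta> * yA g"
  by (simp_all add: xA_def yA_def \<theta>_inverse_assoc)

lemma abs_relator: "r \<in> relators \<Longrightarrow> abs_alg_A r = 0"
  by (simp add: zero_alg_A.abs_eq alg_A.abs_eq_iff ideal_A_def hull_inc)

lemmas relator_simps = minus_alg_A.abs_eq[symmetric] plus_alg_A.abs_eq[symmetric]
  times_alg_A.abs_eq[symmetric] scale_A.abs_eq[symmetric] O_A.abs_eq[symmetric] O_B.abs_eq[symmetric]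

lemma cubic_xA_yA:
  assumes "O_A h * O_A k * O_B m + O_B m * O_A k * O_A h = O_B h * O_B n * O_B h"
  shows "cubic xA yA h k m n"
proof -
  have c: "O_A g * (\<theta>' * z) = \<theta>' * (O_A g * z)" "O_B g * (\<theta>' * z) = \<theta>' * (O_B g * z)" for g z
    by (metis \<theta>_central(2) mult.assoc)+
  show ?thesis
    using assms by (simp add: cubic_def xA_def yA_def mult.assoc c flip: distrib_left)
qed

lemma cubic_yA_xA:
  assumes "O_B h * O_B k * O_A m + O_A m * O_B k * O_B h = O_A h * O_A n * O_A h"
  shows "cubic yA xA h k m n"
proof -
  have c: "O_A g * (\<theta>' * z) = \<theta>' * (O_A g * z)" "O_B g * (\<theta>' * z) = \<theta>' * (O_B g * z)" for g z
    by (metis \<theta>_central(2) mult.assoc)+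
  show ?thesis
    using assms by (simp add: cubic_def xA_def yA_def mult.assoc c flip: distrib_left)
qed

lemma normalized_family_xA_yA: "normalized_family xA yA"
proof
  fix g g1 g2 g3 h
  have c: "O_A g * (\<theta>' * z) = \<theta>' * (O_A g * z)" "O_B g * (\<theta>' * z) = \<theta>' * (O_B g * z)" for g z
    by (metis \<theta>_central(2) mult.assoc)+
  note simps = xA_def yA_def mult.assoc c
  note rel = abs_relator[OF relators.R0A] abs_relator[OF relators.R0B]
    abs_relator[OF relators.R1[of Lab_A]] abs_relator[OF relators.R1[of Lab_B]]
    abs_relator[OF relators.R2] abs_relator[OF relators.R3]
    abs_relator[OF relators.R4[of Lab_A]] abs_relator[OF relators.R4[of Lab_B]]
    abs_relator[OF relators.R5[of Lab_A]] abs_relator[OF relators.R5[of Lab_B]]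
    abs_relator[OF relators.R6] abs_relator[OF relators.R7]
    abs_relator[OF relators.R8] abs_relator[OF relators.R9]
    abs_relator[OF relators.R10] abs_relator[OF relators.R11]
  note rel = rel[unfolded relator_simps right_minus_eq]
  \<comment> \<open>Rescaling puts three factors \<open>\<theta>'\<close> before a cubic monomial;
    the relation supplies \<open>\<theta> * \<theta>\<close>, which absorbs two of them.\<close>
  have cube: "\<theta>' * (\<theta>' * (\<theta>' * z)) = \<theta>' * w" if "z + kap ^ 2 *\<^sub>A w = 0" for z w
  proof -
    have "z = \<theta> * (\<theta> * w)"
      using that by (simp add: scale_A_eq emb_kap_sq mult.assoc)
    then show ?thesis by (simp add: \<theta>_inverse_assoc)
  qed
  show "xA (gen_a * g) = xA g" "yA (gen_b * g) = yA g"
    by (simp_all add: simps rel(1,2))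
  show "xA g * xA g = xA 1 * xA 1" "yA g * yA g = yA 1 * yA 1"
    using rel(3,4)[of g] by (simp_all add: simps)
  show "yA g1 * xA g2 * yA g3 = 0" "xA g1 * yA g2 * xA g3 = 0"
    using rel(5)[of g1 g2 g3] rel(6)[of g1 g2 g3] by (simp_all add: simps)
  show "xA 1 * xA 1 * xA g = xA g" "yA 1 * yA 1 * yA g = yA g"
    "xA g * xA 1 * xA 1 = xA g" "yA g * yA 1 * yA 1 = yA g"
    using rel(7-10)[of g, THEN cube] by (simp_all add: simps)
  have "\<theta>' * (\<theta>' * (\<theta>' * (O_A 1 * (O_A 1 * O_B g) + O_B g * (O_A 1 * O_A 1)))) = \<theta>' * O_B g"
    "\<theta>' * (\<theta>' * (\<theta>' * (O_B 1 * (O_B 1 * O_A g) + O_A g * (O_B 1 * O_B 1)))) = \<theta>' * O_A g"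
    by (rule cube, use rel(11,12)[of g] in \<open>simp add: mult.assoc add_ac\<close>)+
  then show "xA 1 * xA 1 * yA g + yA g * xA 1 * xA 1 = yA g"
    "yA 1 * yA 1 * xA g + xA g * yA 1 * yA 1 = xA g"
    by (simp_all add: simps flip: distrib_left)
  show "cubic xA yA h (g * gen_a * gen_b * gen_a * h) (gen_a * h) (\<sigma> g * h)"
    by (rule cubic_xA_yA) (rule rel(13))
  show "cubic yA xA h (g * gen_b * gen_a * gen_b * h) (gen_b * h) (\<sigma> g * h)"
    by (rule cubic_yA_xA) (rule rel(14))
  show "cubic xA yA h (g * inverse gen_a * inverse gen_b * inverse gen_a * h)
      (inverse gen_a * h) (\<sigma> g * h)"
    by (rule cubic_xA_yA) (rule rel(15))
  show "cubic yA xA h (g * inverse gen_b * inverse gen_a * inverse gen_b * h)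
      (inverse gen_b * h) (\<sigma> g * h)"
    by (rule cubic_yA_xA) (rule rel(16))
qed

text \<open>The inverse of \<open>imag * Q\<close> is \<open>- (imag * inverse Q)\<close>, so the
  plus sign in \<open>yt\<close> reproduces the minus sign in \<open>aut_a\<close>.\<close>

interpretation gen: twisted_family xA yA "emb (imag * Q)" "emb (inverse (imag * Q))"
proof -
  interpret normalized_family xA yA by (rule normalized_family_xA_yA)
  show "twisted_family xA yA (emb (imag * Q)) (emb (inverse (imag * Q)))"
  proof
    show "emb (imag * Q) * emb (inverse (imag * Q)) = 1"
      by (rule emb_inverse) (simp add: imag_nonzero Q_nonzero)
  qed (rule emb_central)+
qed

text \<open>Existence of both maps reduces to a normalised family: the swapped one gives
  \<open>s\<close>, the twisted one \<open>a\<close>.\<close>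

lemma ex_hom_of_family:
  assumes "normalized_family x y"
  shows "\<exists>f. alg_hom f \<and> (\<forall>g. f (O_A g) = \<theta> * x g) \<and> (\<forall>g. f (O_B g) = \<theta> * y g)"
proof -
  let ?F = "\<lambda>(X, g). case X of Lab_A \<Rightarrow> \<theta> * x g | Lab_B \<Rightarrow> \<theta> * y g"
  have "word_eval ?F r = 0" if "r \<in> relators" for r
    by (rule relators_vanish[OF assms that]) simp_all
  from ex_alg_hom[OF this] show ?thesis by auto
qed

section \<open>Matching the twist with the prescribed values of \<open>a\<close>\<close>

lemma a_value_A:
  "- (inverse (kap ^ 2) *\<^sub>A (O_A 1 * O_A (g * inverse gen_a) * O_A 1)) = \<theta> * gen.xt g"
proof -
  have c: "xA g * (\<theta> * z) = \<theta> * (xA g * z)" for g z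
    by (metis \<theta>_central(1) mult.assoc)
  have "emb (inverse (kap ^ 2)) * (\<theta> * (\<theta> * z)) = - z" for z
  proof -
    have "emb (inverse (kap ^ 2)) * - (emb (kap ^ 2) * z) = - z"
      using emb_inverse(2)[of "kap ^ 2"] kap_nonzero by (simp flip: mult.assoc)
    then show ?thesis by (simp add: emb_kap_sq mult.assoc)
  qed
  then show ?thesis
    by (simp add: scale_A_eq gen.xt_def O_A_eq mult.assoc c)
qed

lemma a_value_B:
  "inverse kap *\<^sub>A (Q *\<^sub>A (O_A 1 * O_B (g * inverse gen_a))
     - inverse Q *\<^sub>A (O_B (g * inverse gen_a) * O_A 1)) = \<theta> * gen.yt g"
proof -
  have c: "xA g * (\<theta> * z) = \<theta> * (xA g * z)" "yA g * (\<theta> * z) = \<theta> * (yA g * z)" for g z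
    by (metis \<theta>_central(1) mult.assoc)+
  have e: "emb d * (\<theta> * z) = \<theta> * (emb d * z)" for d z
    by (metis \<theta>_central(1) mult.assoc)
  have \<theta>_kap: "\<theta> * (emb (inverse kap) * z) = emb imag * z" for z
  proof -
    have "imag * kap * inverse kap = imag"
      using kap_nonzero by simp
    then show ?thesis
      by (simp only: \<theta>_def emb_mult[symmetric] mult.assoc[symmetric])
  qed
  have "inverse imag = - imag"
    using imag_imag by (intro inverse_unique) simp
  then have q': "inverse (imag * Q) = - (imag * inverse Q)"
    by simp
  have "gen.yt g = emb imag * (emb Q * (xA 1 * yA (g * inverse gen_a)))
      - emb imag * (emb (inverse Q) * (yA (g * inverse gen_a) * xA 1))"
    by (subst gen.yt_def) (simp only: q' emb_minus emb_mult, simp add: mult.assoc)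
  then show ?thesis
    by (simp add: scale_A_eq O_A_eq O_B_eq mult.assoc c right_diff_distrib e \<theta>_kap)
qed

theorem theorem32:
  shows "(aut_a \<circ> aut_s) ^^ 3 = id \<and> aut_s ^^ 2 = id"
proof -
  obtain s where s: "alg_hom s" "\<And>g. s (O_A g) = O_B (\<sigma> g)" "\<And>g. s (O_B g) = O_A (\<sigma> g)"
    using ex_hom_of_family[OF normalized_family_swap[OF normalized_family_xA_yA]]
    by (auto simp: O_A_eq O_B_eq)
  obtain a where a: "alg_hom a" "\<And>g. a (O_A g) = \<theta> * gen.xt g" "\<And>g. a (O_B g) = \<theta> * gen.yt g"
    using ex_hom_of_family[OF gen.normalized_family_twist] by auto
  have s_s: "s \<circ> s = id"
    using s by (intro alg_hom_eqI alg_hom_comp alg_hom_id) (simp_all add: \<sigma>_simps)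
  define t where "t = a \<circ> s"
  have t: "alg_hom t"
    unfolding t_def by (intro alg_hom_comp a s)
  have t_\<theta>: "t \<theta> = \<theta>" "t \<theta>' = \<theta>'"
    using alg_hom_simps(5)[OF t] by (simp_all add: \<theta>_def \<theta>'_def)
  have t_x: "t (xA g) = gen.yt (\<sigma> g)" and t_y: "t (yA g) = gen.xt (\<sigma> g)" for g
    using alg_hom_simps(3)[OF t, of \<theta>' "O_A g"] alg_hom_simps(3)[OF t, of \<theta>' "O_B g"]
    by (simp_all add: xA_def[of g] yA_def[of g] t_\<theta>)
      (simp_all add: t_def s a \<theta>_inverse_assoc)
  have t_t_t: "t \<circ> t \<circ> t = id"
  proof (rule alg_hom_eqI)
    note o3 = gen.order_three[of t, OF alg_hom_simps(2,3)[OF t] alg_hom_simps(5,5)[OF t] t_x t_y]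
    show "(t \<circ> t \<circ> t) (O_A g) = id (O_A g)" "(t \<circ> t \<circ> t) (O_B g) = id (O_B g)" for g
      by (simp_all add: O_A_eq O_B_eq alg_hom_simps(3)[OF t] t_\<theta> o3)
  qed (intro alg_hom_comp alg_hom_id t)+
  \<comment> \<open>\<open>s\<close> is its own inverse, \<open>t \<circ> t\<close> inverts
    \<open>t\<close>, and \<open>a\<close> is a composite of these bijections.\<close>
  have bij_s: "bij s"
    using s_s by (rule o_bij) (rule s_s)
  have "bij t"
    by (rule o_bij[of "t \<circ> t"]) (use t_t_t in \<open>simp_all add: o_assoc\<close>)
  moreover have "a = t \<circ> s"
    by (simp add: t_def s_s flip: o_assoc)
  ultimately have bij_a: "bij a"
    using bij_s by (simp add: bij_comp)
  have aut: "alg_automorphism f \<longleftrightarrow> bij f \<and> alg_hom f" for f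
    by (auto simp: alg_automorphism_def alg_hom_def)
  \<comment> \<open>The definite description has a unique solution because a homomorphism is
    determined by its values on the generators.\<close>
  have "aut_s = s"
    unfolding aut_s_def
    by (rule the_equality) (use s bij_s aut in \<open>auto intro: alg_hom_eqI\<close>)
  moreover have "aut_a = a"
    unfolding aut_a_def a_value_A a_value_B
    by (rule the_equality) (use a bij_a aut in \<open>auto intro: alg_hom_eqI\<close>)
  ultimately show ?thesis
    using s_s t_t_t by (simp add: t_def numeral_3_eq_3 numeral_2_eq_2 o_assoc)
qed

end
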